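(* Fix an index $i$ and scalars $\mu_i$, $\lambda$ and $\rho_i>0$. Let $A_i,B_i,C_i,D_i,L_i,T_i$ be given real matrices as in the context ($A_i$ is not assumed stable). Suppose there exist real matrices $Y_i,X_i,\hat G_i$, with $Y_i,X_i$ symmetric, such that ($*$ denotes blocks determined by symmetry) $$\mathrm{Tr}(Y_iL_i^TL_i)<\mu_i,\qquad \begin{bmatrix} Y_i & I \\ I & X_i \end{bmatrix}\succ0,$$ $$\begin{bmatrix} X_i & X_iA_i-\hat G_iC_i & X_iB_i-\hat G_iD_i \\ * & X_i & 0 \\ * & * & I \end{bmatrix}\succ0,$$ $$\begin{bmatrix} X_i & 0 & X_iA_i-\hat G_iC_i & \hat G_iC_iT_i \\ * & \frac{\lambda}{\rho_i^2}I & L_i & 0 \\ * & * & X_i & 0 \\ * & * & * & I \end{bmatrix}\succ0.$$ Then there exists an admissible filter matrix $G_i$, i.e. one such that $A_i-G_iC_i$ is stable and $$\|L_i(zI-(A_i-G_iC_i))^{-1}(B_i-G_iD_i)\|_2^2\le\mu_i,\qquad \rho_i^2\,\|L_i(zI-(A_i-G_iC_i))^{-1}G_iC_iT_i\|_\infty^2\le\lambda .$$ Moreover, such a matrix is recovered by setting $G_i=X_i^{-1}\hat G_i$.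
   Context: **System.** $x_{i,t+1}=A_ix_{i,t}+B_iw_{i,t}$, $y_{i,t}=C_ix_{i,t}+D_iw_{i,t}$, with $w_i$ standard white Gaussian noise and quantity of interest $z_i=L_ix_i$. $D_i$ has full row rank, $(A_i,C_i)$ is detectable and $(A_i,B_i)$ is stabilizable. $T_i$ is a diagonal matrix with entries in $\{0,1\}$, of the same size as $A_i$. **Filter.** $\hat x_{i,t+1}=(A_i-G_iC_i)\hat x_{i,t}+G_iy_{i,t}$, $\hat z_{i,t}=L_i\hat x_{i,t}$, with $G_i$ the only design variable. The error $e_i=x_i-\hat x_i$ satisfies $e_{i,t+1}=(A_i-G_iC_i)e_{i,t}+(B_i-G_iD_i)w_{i,t}$. It is required that $A_i-G_iC_i$ be stable (all eigenvalues in the open unit disk). The matrices $X_i,Y_i$ have the size of $A_i$ and $\hat G_i$ has the size of $G_i$. **Norms.** For a stable discrete-time transfer function $\mathcal G(z)$, $$\|\mathcal G\|_2=\Big(\tfrac1{2\pi}\int_{-\pi}^{\pi}\mathrm{Tr}\big(\mathcal G^*(e^{i\omega})\mathcal G(e^{i\omega})\big)d\omega\Big)^{1/2},\qquad \|\mathcal G\|_\infty=\operatorname{ess\,sup}_{\omega\in[-\pi,\pi)}\sigma_{\max}(\mathcal G(e^{i\omega})),$$ where $\sigma_{\max}$ is the largest singular value. The notation $\succ0$ means symmetric positive definite. *)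

theory Defs
  imports "HOL-Probability.Essential_Supremum"
begin

abbreviation cmat :: "real^'n^'m \<Rightarrow> complex^'n^'m" where
  "cmat \<equiv> map_matrix complex_of_real"

definition conj_transpose :: "complex^'n^'m \<Rightarrow> complex^'m^'n" where
  "conj_transpose M = map_matrix cnj (transpose M)"

definition eigenvalue :: "complex^'n^'n \<Rightarrow> complex \<Rightarrow> bool" where
  "eigenvalue M z \<longleftrightarrow> (\<exists>v. v \<noteq> 0 \<and> M *v v = z *s v)"

definition posdef :: "real^'n^'n \<Rightarrow> bool" where
  "posdef M \<longleftrightarrow> transpose M = M \<and> (\<forall>x. x \<noteq> 0 \<longrightarrow> x \<bullet> (M *v x) > 0)"

(* When M has fewer rows than columns this set may contain an extra 0 compared with the
   convention listing min(rows, columns) singular values; the maximum is the same. *)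
definition singular_values :: "complex^'n^'m \<Rightarrow> real set" where
  "singular_values M =
     {s. 0 \<le> s \<and> eigenvalue (conj_transpose M ** M) (complex_of_real (s\<^sup>2))}"

definition sigma_max :: "complex^'n^'m \<Rightarrow> real" where
  "sigma_max M = Max (singular_values M)"

definition hcat :: "'a^'n1^'m \<Rightarrow> 'a^'n2^'m \<Rightarrow> 'a^('n1 + 'n2)^'m" where
  "hcat P Q = (\<chi> i j. case j of Inl j1 \<Rightarrow> P $ i $ j1 | Inr j2 \<Rightarrow> Q $ i $ j2)"

definition vcat :: "'a^'n^'m1 \<Rightarrow> 'a^'n^'m2 \<Rightarrow> 'a^'n^('m1 + 'm2)" where
  "vcat P Q = (\<chi> i. case i of Inl i1 \<Rightarrow> P $ i1 | Inr i2 \<Rightarrow> Q $ i2)"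

(* Arguments of the following are the blocks on and above the diagonal, row by row;
   the blocks below the diagonal are the transposes of those above it. *)
definition sym_block2 ::
    "real^'a^'a \<Rightarrow> real^'b^'a \<Rightarrow> real^'b^'b \<Rightarrow> real^('a + 'b)^('a + 'b)" where
  "sym_block2 P11 P12 P22 = vcat (hcat P11 P12) (hcat (transpose P12) P22)"

definition sym_block3 ::
    "real^'a^'a \<Rightarrow> real^'b^'a \<Rightarrow> real^'c^'a \<Rightarrow>
     real^'b^'b \<Rightarrow> real^'c^'b \<Rightarrow>
     real^'c^'c \<Rightarrow> real^('a + 'b + 'c)^('a + 'b + 'c)" where
  "sym_block3 P11 P12 P13 P22 P23 P33 =
     sym_block2 P11 (hcat P12 P13) (sym_block2 P22 P23 P33)"

definition sym_block4 ::
    "real^'a^'a \<Rightarrow> real^'b^'a \<Rightarrow> real^'c^'a \<Rightarrow> real^'d^'a \<Rightarrow>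
     real^'b^'b \<Rightarrow> real^'c^'b \<Rightarrow> real^'d^'b \<Rightarrow>
     real^'c^'c \<Rightarrow> real^'d^'c \<Rightarrow>
     real^'d^'d \<Rightarrow> real^('a + 'b + 'c + 'd)^('a + 'b + 'c + 'd)" where
  "sym_block4 P11 P12 P13 P14 P22 P23 P24 P33 P34 P44 =
     sym_block2 P11 (hcat P12 (hcat P13 P14)) (sym_block3 P22 P23 P24 P33 P34 P44)"

definition schur_stable :: "real^'n^'n \<Rightarrow> bool" where
  "schur_stable A \<longleftrightarrow> (\<forall>z. eigenvalue (cmat A) z \<longrightarrow> norm z < 1)"

definition detectable :: "real^'n^'n \<Rightarrow> real^'n^'p \<Rightarrow> bool" where
  "detectable A C \<longleftrightarrow> (\<exists>G :: real^'p^'n. schur_stable (A - G ** C))"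

definition stabilizable :: "real^'n^'n \<Rightarrow> real^'w^'n \<Rightarrow> bool" where
  "stabilizable A B \<longleftrightarrow> (\<exists>K :: real^'n^'w. schur_stable (A - B ** K))"

(* matrix_inv is meaningful here only when z is not an eigenvalue of A,
   in particular on the unit circle when A is stable. *)
definition transfer_function ::
    "real^'n^'q \<Rightarrow> real^'n^'n \<Rightarrow> real^'m^'n \<Rightarrow> complex \<Rightarrow> complex^'m^'q" where
  "transfer_function L A B z = cmat L ** matrix_inv (mat z - cmat A) ** cmat B"

(* The trace of the integrand is real, so Re only changes its type.  The Lebesgue integral is 0
   for a non-integrable integrand; for the transfer function of a stable system the integrand is
   continuous in the frequency. *)
definition h2_norm :: "(complex \<Rightarrow> complex^'m^'q) \<Rightarrow> real" where
  "h2_norm \<G> = sqrt (1 / (2 * pi) *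
     (LBINT \<omega>:{-pi..pi}. Re (trace (conj_transpose (\<G> (cis \<omega>)) ** \<G> (cis \<omega>)))))"

definition hinf_norm :: "(complex \<Rightarrow> complex^'m^'q) \<Rightarrow> ereal" where
  "hinf_norm \<G> =
     esssup (restrict_space lborel {-pi..<pi}) (\<lambda>\<omega>. ereal (sigma_max (\<G> (cis \<omega>))))"

end

theory Submission
  imports Defs "HOL-Complex_Analysis.Cauchy_Integral_Formula"
begin

text \<open>Write \<open>M = A - G C\<close>, \<open>N = B - G D\<close> and \<open>K = G C T\<close>; since \<open>X G\<close> is the given matrix \<open>Ghat\<close>,
  the off-diagonal blocks of the inequalities are \<open>X M\<close>, \<open>X N\<close> and \<open>X K\<close>. A positive definite real
  block matrix gives a positive quadratic form on complex vectors, and everything follows by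
  choosing test vectors. With an eigenvector of \<open>M\<close> the three-block inequality gives stability. With
  \<open>z x = M x + K w\<close>, \<open>|z| = 1\<close>, the four-block inequality gives the gain bound
  \<open>\<rho>\<^sup>2 |L x|\<^sup>2 \<le> lam |w|\<^sup>2\<close> at each frequency. For the \<open>H\<^sub>2\<close> norm, let \<open>P = X\<^sup>-\<^sup>1\<close> and
  \<open>u = (I - z M\<^sup>T)\<^sup>-\<^sup>1 l\<close> for \<open>l\<close> a row of \<open>L\<close>: the Lyapunov inequality
  bounds the integrand by \<open>2 Re (u\<^sup>* P l) - l\<^sup>T P l\<close>, and the mean value property of the
  holomorphic function \<open>u\<close> of \<open>z\<close> turns the average of this bound into \<open>l\<^sup>T P l \<le> l\<^sup>T Y l\<close>.\<close>

subsection \<open>Complex matrices as real-linear maps\<close>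

lemma conj_transpose_nth [simp]: "conj_transpose M $ i $ j = cnj (M $ j $ i)"
  by (simp add: conj_transpose_def transpose_def)

lemma conj_transpose_conj_transpose [simp]: "conj_transpose (conj_transpose M) = M"
  by (simp add: vec_eq_iff)

lemma conj_transpose_matrix_mul: "conj_transpose (M ** N) = conj_transpose N ** conj_transpose M"
  by (simp add: vec_eq_iff matrix_matrix_mult_def mult.commute)

lemma conj_transpose_diff: "conj_transpose (M - N) = conj_transpose M - conj_transpose N"
  by (simp add: vec_eq_iff)

lemma conj_transpose_mat [simp]: "conj_transpose (mat z) = mat (cnj z)"
  by (auto simp: vec_eq_iff mat_def)

lemma conj_transpose_cmat [simp]: "conj_transpose (cmat M) = cmat (transpose M)"
  by (simp add: vec_eq_iff transpose_def)

lemma cmat_matrix_mul: "cmat (M ** N) = cmat M ** cmat N"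
  by (simp add: vec_eq_iff matrix_matrix_mult_def)

lemma cmat_0 [simp]: "cmat 0 = 0"
  by (simp add: vec_eq_iff)

lemma cmat_mat [simp]: "cmat (mat r) = mat (complex_of_real r)"
  by (auto simp: vec_eq_iff mat_def)

lemma cmat_scaleR: "cmat (r *\<^sub>R M) = r *\<^sub>R cmat M"
  by (auto simp: vec_eq_iff complex_eq_iff)

lemma mat_vector_mult: "mat z *v v = z *s (v :: complex^'n)"
  by (simp add: vec_eq_iff matrix_vector_mult_def mat_def if_distrib if_distribR cong: if_cong)

lemma scaleR_matrix_vector_mult:
  "(r *\<^sub>R M) *v v = r *\<^sub>R (M *v (v :: complex^'n))"
  by (simp add: vec_eq_iff matrix_vector_mult_def scaleR_right.sum)

lemma matrix_vector_mult_scaleR_right: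
  "M *v (r *\<^sub>R v) = r *\<^sub>R (M *v (v :: complex^'n))"
  by (simp add: vec_eq_iff matrix_vector_mult_def scaleR_right.sum)

lemma matrix_vector_mult_minus_right: "M *v (- v) = - (M *v (v :: complex^'n))"
  by (simp add: vec_eq_iff matrix_vector_mult_def sum_negf)

text \<open>On complex vectors \<open>\<bullet>\<close> is the real inner product
  \<open>Re (a^* b)\<close>. The conjugate transpose is still the adjoint for it, so every quadratic
  form below is real-valued without further argument.\<close>

lemma inner_matrix_vector_mult:
  fixes M :: "complex^'n^'m"
  shows "a \<bullet> (M *v b) = (conj_transpose M *v a) \<bullet> b"
proof -
  have "a \<bullet> (M *v b) = (\<Sum>i\<in>UNIV. \<Sum>j\<in>UNIV. Re (cnj (a $ i) * (M $ i $ j * b $ j)))"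
    by (simp add: inner_vec_def inner_complex_def matrix_vector_mult_def sum_distrib_left
        sum.distrib sum_subtractf algebra_simps)
  also have "\<dots> = (\<Sum>j\<in>UNIV. \<Sum>i\<in>UNIV. Re (cnj (a $ i) * (M $ i $ j * b $ j)))"
    by (rule sum.swap)
  also have "\<dots> = (conj_transpose M *v a) \<bullet> b"
    by (simp add: inner_vec_def inner_complex_def matrix_vector_mult_def sum_distrib_left
        sum_distrib_right sum.distrib sum_subtractf algebra_simps)
  finally show ?thesis .
qed

lemma inner_cmat_vector_mult:
  "a \<bullet> (cmat M *v b) = (cmat (transpose M) *v a) \<bullet> b"
  by (simp add: inner_matrix_vector_mult)

text \<open>In each coordinate, multiplication by \<open>z\<close> is a rotation of the plane
  followed by a dilation by \<open>norm z\<close>.\<close>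

lemma inner_complex_scale: "(z *s a) \<bullet> (z *s b) = (norm z)\<^sup>2 * (a \<bullet> (b :: complex^'n))"
proof -
  have "(z * x) \<bullet> (z * y) = (norm z)\<^sup>2 * (x \<bullet> y)" for x y
    unfolding cmod_power2 inner_complex_def by (simp add: power2_eq_square algebra_simps)
  then show ?thesis
    by (simp add: inner_vec_def sum_distrib_left)
qed

text \<open>Cauchy-Schwarz in every row; the norm of a matrix is here its Frobenius norm.\<close>

lemma norm_matrix_vector_mult_le:
  fixes M :: "complex^'n^'m"
  shows "norm (M *v v) \<le> norm M * norm v"
proof -
  have "norm ((M *v v) $ i) \<le> norm (M $ i) * norm v" for i
  proof -
    have "norm ((M *v v) $ i) \<le> (\<Sum>j\<in>UNIV. \<bar>norm (M $ i $ j)\<bar> * \<bar>norm (v $ j)\<bar>)"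
      unfolding matrix_vector_mult_def by (simp add: norm_mult flip: norm_mult) (rule norm_sum)
    also have "\<dots> \<le> norm (M $ i) * norm v"
      unfolding norm_vec_def by (rule L2_set_mult_ineq)
    finally show ?thesis .
  qed
  then have "norm (M *v v) \<le> L2_set (\<lambda>i. norm (M $ i) * norm v) UNIV"
    unfolding norm_vec_def[of "M *v v"] by (intro L2_set_mono) auto
  also have "\<dots> = norm M * norm v"
    unfolding norm_vec_def[of M] by (simp add: L2_set_left_distrib)
  finally show ?thesis .
qed

lemma invertible_iff_inj:
  fixes M :: "'a::field^'n^'n"
  shows "invertible M \<longleftrightarrow> (\<forall>v. M *v v = 0 \<longrightarrow> v = 0)"
  by (metis invertible_left_inverse matrix_left_invertible_ker)

lemma matrix_inv_mult:
  fixes M :: "'a::semiring_1^'n^'m"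
  assumes "invertible M"
  shows "M ** matrix_inv M = mat 1" "matrix_inv M ** M = mat 1"
  using someI_ex[OF assms[unfolded invertible_def]] by (auto simp: matrix_inv_def)

lemma posdef_invertible: "posdef X \<Longrightarrow> invertible X"
  unfolding invertible_iff_inj posdef_def by (metis inner_zero_right less_irrefl)

lemma transpose_matrix_inv_eq:
  fixes X :: "'a::field^'n^'n"
  assumes "invertible X" and "transpose X = X"
  shows "transpose (matrix_inv X) = matrix_inv X"
proof -
  have "transpose (matrix_inv X) ** X = mat 1"
    by (metis assms matrix_inv_mult(1) matrix_transpose_mul transpose_mat)
  then show ?thesis
    by (metis assms(1) matrix_inv_mult(1) matrix_mul_assoc matrix_mul_lid matrix_mul_rid)
qed

subsection \<open>Quadratic forms of block matrices\<close>

definition vjoin :: "'a^'m \<Rightarrow> 'a^'n \<Rightarrow> 'a^('m + 'n)" where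
  "vjoin x y = (\<chi> i. case i of Inl j \<Rightarrow> x $ j | Inr j \<Rightarrow> y $ j)"

lemma sum_UNIV_Plus:
  fixes f :: "'m::finite + 'n::finite \<Rightarrow> 'b::comm_monoid_add"
  shows "sum f UNIV = (\<Sum>i\<in>UNIV. f (Inl i)) + (\<Sum>i\<in>UNIV. f (Inr i))"
  using sum.Plus[of "UNIV :: 'm set" "UNIV :: 'n set" f] by (simp add: o_def)

lemma hcat_mult_vjoin: "hcat P Q *v vjoin x y = P *v x + Q *v y"
  by (simp add: vec_eq_iff matrix_vector_mult_def hcat_def vjoin_def sum_UNIV_Plus)

lemma vcat_mult: "vcat P Q *v x = vjoin (P *v x) (Q *v x)"
  by (simp add: vec_eq_iff matrix_vector_mult_def vcat_def vjoin_def split: sum.split)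

lemma inner_vjoin: "vjoin a b \<bullet> vjoin c d = a \<bullet> c + b \<bullet> d"
  by (simp add: inner_vec_def vjoin_def sum_UNIV_Plus)

lemma vjoin_eq_0_iff: "vjoin a b = 0 \<longleftrightarrow> a = 0 \<and> b = 0"
  by (auto simp: vec_eq_iff vjoin_def split: sum.split sum.split_asm)

lemma cmat_hcat: "cmat (hcat P Q) = hcat (cmat P) (cmat Q)"
  by (simp add: vec_eq_iff hcat_def split: sum.split)

lemma cmat_vcat: "cmat (vcat P Q) = vcat (cmat P) (cmat Q)"
  by (simp add: vec_eq_iff vcat_def split: sum.split)

text \<open>Both off-diagonal blocks contribute the same term, since the lower one is the transpose
  of the upper one and the real inner product is symmetric.\<close>

lemma inner_sym_block2:
  "vjoin a b \<bullet> (cmat (sym_block2 P Q R) *v vjoin a b)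
     = a \<bullet> (cmat P *v a) + 2 * (a \<bullet> (cmat Q *v b)) + b \<bullet> (cmat R *v b)"
  unfolding sym_block2_def cmat_vcat cmat_hcat vcat_mult hcat_mult_vjoin inner_vjoin
  by (simp add: inner_add_right inner_cmat_vector_mult[of b] inner_commute[of "cmat Q *v b"])

text \<open>For a real matrix the real part of the form splits into the forms of the real and
  imaginary parts of \<open>v\<close>, without cross terms.\<close>

lemma posdef_cmat:
  fixes v :: "complex^'n"
  assumes "posdef S" "v \<noteq> 0"
  shows "v \<bullet> (cmat S *v v) > 0"
proof -
  define p q where "p = (\<chi> i. Re (v $ i))" and "q = (\<chi> i. Im (v $ i))"
  have eq: "v \<bullet> (cmat S *v v) = p \<bullet> (S *v p) + q \<bullet> (S *v q)"
    by (simp add: p_def q_def inner_vec_def inner_complex_def matrix_vector_mult_def sum.distrib)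
  have "p \<noteq> 0 \<or> q \<noteq> 0"
    using assms(2) by (auto simp: p_def q_def vec_eq_iff complex_eq_iff)
  then show ?thesis
    using assms(1) unfolding eq posdef_def
    by (metis add_nonneg_pos add_pos_nonneg inner_zero_left less_eq_real_def)
qed

lemma posdef_sym_block2:
  assumes "posdef (sym_block2 P Q R)" "a \<noteq> 0 \<or> b \<noteq> 0"
  shows "a \<bullet> (cmat P *v a) + 2 * (a \<bullet> (cmat Q *v b)) + b \<bullet> (cmat R *v b) > 0"
  using posdef_cmat[OF assms(1), of "vjoin a b"] assms(2)
  by (simp add: vjoin_eq_0_iff inner_sym_block2)

lemma posdef_sym_block3:
  assumes "posdef (sym_block3 P11 P12 P13 P22 P23 P33)" "a \<noteq> 0 \<or> b \<noteq> 0 \<or> c \<noteq> 0"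
  shows "a \<bullet> (cmat P11 *v a) + 2 * (a \<bullet> (cmat P12 *v b)) + 2 * (a \<bullet> (cmat P13 *v c))
    + b \<bullet> (cmat P22 *v b) + 2 * (b \<bullet> (cmat P23 *v c)) + c \<bullet> (cmat P33 *v c) > 0"
  using posdef_sym_block2[OF assms(1)[unfolded sym_block3_def], of a "vjoin b c"] assms(2)
  by (simp add: vjoin_eq_0_iff inner_sym_block2 cmat_hcat hcat_mult_vjoin inner_add_right)

lemma posdef_sym_block4:
  assumes "posdef (sym_block4 P11 P12 P13 P14 P22 P23 P24 P33 P34 P44)"
    and "a \<noteq> 0 \<or> b \<noteq> 0 \<or> c \<noteq> 0 \<or> d \<noteq> 0"
  shows "a \<bullet> (cmat P11 *v a) + 2 * (a \<bullet> (cmat P12 *v b)) + 2 * (a \<bullet> (cmat P13 *v c))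
    + 2 * (a \<bullet> (cmat P14 *v d)) + b \<bullet> (cmat P22 *v b) + 2 * (b \<bullet> (cmat P23 *v c))
    + 2 * (b \<bullet> (cmat P24 *v d)) + c \<bullet> (cmat P33 *v c) + 2 * (c \<bullet> (cmat P34 *v d))
    + d \<bullet> (cmat P44 *v d) > 0"
  using posdef_sym_block2[OF assms(1)[unfolded sym_block4_def], of a "vjoin b (vjoin c d)"] assms(2)
  by (simp add: vjoin_eq_0_iff inner_sym_block2 cmat_hcat hcat_mult_vjoin inner_add_right
      sym_block3_def)

subsection \<open>The largest singular value\<close>

lemma inner_gram: "a \<bullet> ((conj_transpose M ** M) *v b) = (M *v a) \<bullet> (M *v b)"
  by (simp add: inner_matrix_vector_mult conj_transpose_matrix_mul flip: matrix_vector_mul_assoc)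

lemma singular_values_iff:
  fixes M :: "complex^'n^'m"
  shows
  "s \<in> singular_values M \<longleftrightarrow>
     0 \<le> s \<and> (\<exists>v. v \<noteq> 0 \<and> (conj_transpose M ** M) *v v = s\<^sup>2 *\<^sub>R v)"
proof -
  have "complex_of_real r *s v = r *\<^sub>R v" for r and v :: "complex^'n"
    by (auto simp: vec_eq_iff complex_eq_iff)
  then show ?thesis
    by (simp add: singular_values_def eigenvalue_def del: of_real_power)
qed

text \<open>Eigenvectors of the self-adjoint Gram matrix for distinct singular values are
  orthogonal, hence independent, and the dimension is finite. This makes the \<open>Max\<close> in
  \<open>sigma_max\<close> meaningful.\<close>

lemma finite_singular_values: "finite (singular_values M)"
proof -
  let ?S = "conj_transpose M ** M"
  have "\<forall>s\<in>singular_values M. \<exists>v. v \<noteq> 0 \<and> ?S *v v = s\<^sup>2 *\<^sub>R v"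
    by (simp add: singular_values_iff)
  then obtain v where v: "\<And>s. s \<in> singular_values M \<Longrightarrow> v s \<noteq> 0 \<and> ?S *v v s = s\<^sup>2 *\<^sub>R v s"
    by metis
  have orth: "v s \<bullet> v t = 0" if "s \<in> singular_values M" "t \<in> singular_values M" "s \<noteq> t" for s t
  proof -
    have "t\<^sup>2 * (v s \<bullet> v t) = v s \<bullet> (?S *v v t)"
      using v that by simp
    also have "\<dots> = v t \<bullet> (?S *v v s)"
      by (simp add: inner_gram inner_commute)
    also have "\<dots> = s\<^sup>2 * (v s \<bullet> v t)"
      using v that by (simp add: inner_commute)
    finally have "(t\<^sup>2 - s\<^sup>2) * (v s \<bullet> v t) = 0"
      by (simp add: algebra_simps)
    moreover have "t\<^sup>2 \<noteq> s\<^sup>2"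
      using that by (auto simp: singular_values_def power2_eq_iff_nonneg)
    ultimately show ?thesis
      by simp
  qed
  have inj: "inj_on v (singular_values M)"
    using orth v by (intro inj_onI) (metis inner_eq_zero_iff)
  have "pairwise orthogonal (v ` singular_values M)"
    using orth by (auto simp: pairwise_def orthogonal_def)
  moreover have "0 \<notin> v ` singular_values M"
    using v by force
  ultimately have "finite (v ` singular_values M)"
    by (intro finiteI_independent pairwise_orthogonal_independent)
  then show ?thesis
    using inj finite_image_iff by blast
qed

text \<open>The maximum of \<open>norm (M *v v)\<close> over the unit sphere is attained by
  compactness, and a first-order variation shows that a maximiser is an eigenvector of the Gram
  matrix.\<close>

lemma exists_max_singular_value:
  fixes M :: "complex^'n^'m"
  shows "\<exists>s\<in>singular_values M. \<forall>v. norm (M *v v) \<le> s * norm v"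
proof -
  let ?S = "conj_transpose M ** M"
  have "sphere (0::complex^'n) 1 \<noteq> {}"
    by simp
  moreover have "continuous_on (sphere 0 1) (\<lambda>v. norm (M *v v))"
    by (intro continuous_intros linear_continuous_on) (simp add: linear_linear)
  ultimately obtain u where u: "norm u = 1"
      and max: "\<And>v. norm v = 1 \<Longrightarrow> norm (M *v v) \<le> norm (M *v u)"
    using continuous_attains_sup[OF compact_sphere, of 0 1 "\<lambda>v. norm (M *v v)"] by auto
  define s where "s = norm (M *v u)"
  have bound: "norm (M *v v) \<le> s * norm v" for v
  proof (cases "v = 0")
    case False
    have "norm (M *v ((1 / norm v) *\<^sub>R v)) \<le> s"
      unfolding s_def using False by (intro max) simp
    then show ?thesis
      using False by (simp add: matrix_vector_mult_scaleR_right field_simps)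
  qed simp
  \<comment> \<open>The defect \<open>s\<^sup>2 |v|\<^sup>2 - |M v|\<^sup>2\<close> is a nonnegative form vanishing at \<open>u\<close>,
      hence \<open>u\<close> is in its kernel.\<close>
  define d where "d = ?S *v u - s\<^sup>2 *\<^sub>R u"
  define k where "k = s\<^sup>2 * (d \<bullet> d) - (M *v d) \<bullet> (M *v d)"
  have dd: "(M *v u) \<bullet> (M *v d) - s\<^sup>2 * (u \<bullet> d) = d \<bullet> d"
    using inner_gram[of d M u] inner_diff_right[of d "?S *v u" "s\<^sup>2 *\<^sub>R u"]
    by (simp add: d_def[symmetric] inner_commute)
  \<comment> \<open>This is \<open>bound\<close> at \<open>u + t *\<^sub>R d\<close>: the constant
    terms cancel, and by \<open>dd\<close> the linear term is
    \<open>2 * t * (d \<bullet> d)\<close>.\<close>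
  have quad: "2 * t * (d \<bullet> d) \<le> t\<^sup>2 * k" for t
  proof -
    have "(norm (M *v (u + t *\<^sub>R d)))\<^sup>2 \<le> (s * norm (u + t *\<^sub>R d))\<^sup>2"
      by (intro power_mono bound) simp
    then have "(M *v u) \<bullet> (M *v u) + 2 * t * ((M *v u) \<bullet> (M *v d)) + t\<^sup>2 * ((M *v d) \<bullet> (M *v d))
        \<le> s\<^sup>2 * (u \<bullet> u + 2 * t * (u \<bullet> d) + t\<^sup>2 * (d \<bullet> d))"
      unfolding power_mult_distrib power2_norm_eq_inner matrix_vector_right_distrib
        matrix_vector_mult_scaleR_right
      by (simp add: inner_add_left inner_add_right inner_commute power2_eq_square algebra_simps)
    moreover have "(M *v u) \<bullet> (M *v u) = s\<^sup>2" "u \<bullet> u = 1"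
      using u by (simp_all add: s_def flip: power2_norm_eq_inner)
    ultimately show ?thesis
      unfolding k_def dd[symmetric] by (simp add: algebra_simps)
  qed
  have "d \<bullet> d = 0"
  proof (rule ccontr)
    assume "d \<bullet> d \<noteq> 0"
    then have pos: "d \<bullet> d > 0"
      by simp
    \<comment> \<open>A step small enough for the linear term to exceed the quadratic one; the
      \<open>+ 1\<close> keeps the denominator positive when \<open>k = 0\<close>.\<close>
    define t where "t = (d \<bullet> d) / (\<bar>k\<bar> + 1)"
    have "t > 0"
      using pos by (simp add: t_def)
    have "t * k \<le> t * \<bar>k\<bar>"
      using \<open>t > 0\<close> by simp
    also have "\<dots> < d \<bullet> d"
      using pos by (simp add: t_def field_simps)
    finally have "t * k < d \<bullet> d" .
    then have "t * k < 2 * (d \<bullet> d)"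
      using pos by linarith
    then have "t * (t * k) < t * (2 * (d \<bullet> d))"
      using \<open>t > 0\<close> by (rule mult_strict_left_mono)
    then show False
      using quad[of t] by (simp add: power2_eq_square algebra_simps)
  qed
  then have "?S *v u = s\<^sup>2 *\<^sub>R u"
    by (simp add: d_def)
  moreover have "u \<noteq> 0"
    using u by auto
  ultimately have "s \<in> singular_values M"
    by (auto simp: singular_values_iff s_def)
  then show ?thesis
    using bound by blast
qed

lemma sigma_max_mem: "sigma_max M \<in> singular_values M"
  unfolding sigma_max_def using exists_max_singular_value[of M] finite_singular_values[of M]
  by (intro Max_in) auto

lemma norm_le_sigma_max: "norm (M *v v) \<le> sigma_max M * norm v"
proof -
  obtain s where s: "s \<in> singular_values M" "\<And>v. norm (M *v v) \<le> s * norm v"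
    using exists_max_singular_value by blast
  have "s \<le> sigma_max M"
    unfolding sigma_max_def by (intro Max_ge finite_singular_values s)
  then show ?thesis
    by (meson s(2) mult_right_mono norm_ge_zero order_trans)
qed

lemma sigma_max_nonneg: "0 \<le> sigma_max M"
  using sigma_max_mem[of M] by (simp add: singular_values_def)

text \<open>An eigenvector for \<open>sigma_max M\<close> is stretched by exactly that factor.
  Together with \<open>norm_le_sigma_max\<close> this identifies \<open>sigma_max\<close> with the
  operator norm.\<close>

lemma sigma_max_le:
  assumes "\<And>v. norm (M *v v) \<le> c * norm v"
  shows "sigma_max M \<le> c"
proof -
  let ?s = "sigma_max M"
  obtain v where v: "v \<noteq> 0" "(conj_transpose M ** M) *v v = ?s\<^sup>2 *\<^sub>R v"
    using sigma_max_mem[of M] by (auto simp: singular_values_iff)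
  have "(norm (M *v v))\<^sup>2 = (?s * norm v)\<^sup>2"
    using inner_gram[of v M v] v(2)
    by (simp add: power2_norm_eq_inner power_mult_distrib)
  then have "norm (M *v v) = ?s * norm v"
    using sigma_max_nonneg[of M] by (simp add: power2_eq_iff_nonneg)
  then show ?thesis
    using assms[of v] v(1) by simp
qed

text \<open>Triangle inequality for the operator norm, which the Frobenius norm dominates. The
  resulting continuity yields the measurability that \<open>esssup\<close> calls for.\<close>

lemma sigma_max_lipschitz:
  fixes M N :: "complex^'n^'m"
  shows "\<bar>sigma_max M - sigma_max N\<bar> \<le> norm (M - N)"
proof -
  have *: "sigma_max M \<le> sigma_max N + norm (M - N)" for M N :: "complex^'n^'m"
  proof (rule sigma_max_le)
    fix v :: "complex^'n"
    have "norm (M *v v) \<le> norm (N *v v) + norm ((M - N) *v v)"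
      using norm_triangle_ineq[of "N *v v" "(M - N) *v v"]
      by (simp add: matrix_vector_mult_diff_rdistrib)
    also have "\<dots> \<le> sigma_max N * norm v + norm (M - N) * norm v"
      by (intro add_mono norm_le_sigma_max norm_matrix_vector_mult_le)
    finally show "norm (M *v v) \<le> (sigma_max N + norm (M - N)) * norm v"
      by (simp add: algebra_simps)
  qed
  show ?thesis
    using *[of M N] *[of N M] by (simp add: norm_minus_commute)
qed

lemma continuous_on_sigma_max:
  fixes F :: "'a::topological_space \<Rightarrow> complex^'n^'m"
  assumes "continuous_on S F"
  shows "continuous_on S (\<lambda>t. sigma_max (F t))"
proof -
  have "1-lipschitz_on UNIV (sigma_max :: complex^'n^'m \<Rightarrow> real)"
    using sigma_max_lipschitz by (auto simp: lipschitz_on_def dist_norm)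
  then have "continuous_on UNIV (sigma_max :: complex^'n^'m \<Rightarrow> real)"
    by (rule lipschitz_on_continuous_on)
  then show ?thesis
    by (rule continuous_on_compose2[OF _ assms]) simp
qed

subsection \<open>Resolvents on the unit circle\<close>

lemma matrix_vector_mult_axis: "(M *v axis j 1) $ i = (M $ i $ j :: complex)"
  by (simp add: matrix_vector_mult_def axis_def if_distrib cong: if_cong)

lemma holomorphic_on_det:
  fixes F :: "complex \<Rightarrow> complex^'n^'n"
  assumes "\<And>i j. (\<lambda>z. F z $ i $ j) holomorphic_on S"
  shows "(\<lambda>z. det (F z)) holomorphic_on S"
  unfolding det_def by (intro holomorphic_intros assms)

lemma continuous_on_det:
  fixes F :: "'a::topological_space \<Rightarrow> complex^'n^'n"
  assumes "\<And>i j. continuous_on S (\<lambda>t. F t $ i $ j)"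
  shows "continuous_on S (\<lambda>t. det (F t))"
  unfolding det_def by (intro continuous_intros assms)

lemma continuous_on_matrix_mult:
  fixes F :: "'a::topological_space \<Rightarrow> complex^'n^'m" and G :: "'a \<Rightarrow> complex^'p^'n"
  assumes "continuous_on S F" "continuous_on S G"
  shows "continuous_on S (\<lambda>t. F t ** G t)"
  unfolding matrix_matrix_mult_def by (intro continuous_intros assms)

text \<open>By Cramer's rule the entries of the inverse are quotients of determinants;
  \<open>?K t j k\<close> is \<open>F t\<close> with column \<open>k\<close> replaced by the
  \<open>j\<close>-th unit vector.\<close>

lemma continuous_on_matrix_inv:
  fixes F :: "'a::topological_space \<Rightarrow> complex^'n^'n"
  assumes F: "continuous_on S F" and inv: "\<And>t. t \<in> S \<Longrightarrow> invertible (F t)"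
  shows "continuous_on S (\<lambda>t. matrix_inv (F t))"
proof -
  let ?K = "\<lambda>t j k. (\<chi> i l. if l = k then axis j 1 $ i else F t $ i $ l) :: complex^'n^'n"
  have eq: "matrix_inv (F t) = (\<chi> k j. det (?K t j k) / det (F t))" if "t \<in> S" for t
  proof -
    have "F t *v (matrix_inv (F t) *v axis j 1) = axis j 1" for j
      by (simp add: matrix_vector_mul_assoc matrix_inv_mult inv that)
    then have "matrix_inv (F t) *v axis j 1 = (\<chi> k. det (?K t j k) / det (F t))" for j
      using inv[OF that] by (simp add: cramer invertible_det_nz)
    then show ?thesis
      by (simp add: vec_eq_iff matrix_vector_mult_axis)
  qed
  have "continuous_on S (\<lambda>t. ?K t j k $ i $ l)" for i j k l
    by (cases "l = k") (auto intro!: continuous_intros F)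
  then have "continuous_on S (\<lambda>t. (\<chi> k j. det (?K t j k) / det (F t)) :: complex^'n^'n)"
    using inv by (intro continuous_intros continuous_on_det F) (auto simp: invertible_det_nz)
  then show ?thesis
    using eq by (simp cong: continuous_on_cong)
qed

lemma mat_matrix_mult_nth: "(mat z ** M) $ i $ j = z * M $ i $ j"
  by (simp add: matrix_matrix_mult_def mat_def if_distrib if_distribR cong: if_cong)

lemma schur_stable_invertible:
  assumes "schur_stable M" "norm z \<ge> 1"
  shows "invertible (mat z - cmat M)"
  unfolding invertible_iff_inj
proof (intro allI impI)
  fix v assume "(mat z - cmat M) *v v = 0"
  then have "cmat M *v v = z *s v"
    by (simp add: matrix_vector_mult_diff_rdistrib mat_vector_mult)
  then show "v = 0"
    using assms by (auto simp: schur_stable_def eigenvalue_def)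
qed

text \<open>For \<open>z \<noteq> 0\<close> a kernel vector of \<open>I - z M\<close> would be an
  eigenvector of \<open>M\<close> for \<open>1/z\<close>, which lies on or outside the unit circle.
  Transposition preserves the determinant.\<close>

lemma schur_stable_det_nz:
  assumes "schur_stable M" "norm z \<le> 1"
  shows "det (mat 1 - mat z ** cmat (transpose M)) \<noteq> 0"
proof -
  have "v = 0" if "(mat 1 - mat z ** cmat M) *v v = 0" for v
  proof (cases "z = 0")
    case True
    then show ?thesis
      using that by (simp add: matrix_vector_mult_diff_rdistrib)
  next
    case False
    have "v = z *s (cmat M *v v)"
      using that by (simp add: matrix_vector_mult_diff_rdistrib mat_vector_mult
          flip: matrix_vector_mul_assoc)
    then have "(1/z) *s v = (1/z) *s (z *s (cmat M *v v))"
      by simp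
    then have "(mat (1/z) - cmat M) *v v = 0"
      using False by (simp add: matrix_vector_mult_diff_rdistrib mat_vector_mult vector_smult_assoc)
    moreover have "norm (1/z) \<ge> 1"
      using False assms(2) by (simp add: norm_divide)
    ultimately show ?thesis
      using schur_stable_invertible[OF assms(1)] unfolding invertible_iff_inj by blast
  qed
  then have "det (mat 1 - mat z ** cmat M) \<noteq> 0"
    by (simp add: invertible_iff_inj flip: invertible_det_nz)
  moreover have "mat 1 - mat z ** cmat (transpose M) = transpose (mat 1 - mat z ** cmat M)"
    by (auto simp: vec_eq_iff mat_matrix_mult_nth transpose_def) (auto simp: mat_def)
  ultimately show ?thesis
    by (simp add: det_transpose)
qed

text \<open>Cauchy's formula at the centre, where \<open>dz / z = i dt\<close>. The circle is
  parametrised over \<open>{-pi..pi}\<close> to match the integral in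
  \<open>h2_norm\<close>.\<close>

lemma mean_value_unit_circle:
  fixes f :: "complex \<Rightarrow> complex"
  assumes cont: "continuous_on (cball 0 1) f" and hol: "f holomorphic_on ball 0 1"
  shows "((\<lambda>t. f (cis t)) has_integral (2 * pi * f 0)) {-pi..pi}"
proof -
  let ?p = "part_circlepath 0 1 (-pi) pi"
  define W where "W = winding_number ?p 0"
  have *: "((\<lambda>t. \<i> * g (cis t)) has_integral (2 * pi * \<i> * W * g 0)) {-pi..pi}"
    if "continuous_on (cball 0 1) g" "g holomorphic_on ball 0 1" for g
  proof -
    have "((\<lambda>w. g w / (w - 0)) has_contour_integral (2 * pi * \<i> * W * g 0)) ?p"
      unfolding W_def
    proof (rule Cauchy_integral_formula_weak[where S = "cball 0 1" and k = "{}"])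
      show "path_image ?p \<subseteq> cball 0 1 - {0}"
        by (auto simp: path_image_part_circlepath' norm_mult)
      show "pathfinish ?p = pathstart ?p"
        by (simp add: exp_minus flip: cis_conv_exp)
    qed (use that in \<open>auto simp: holomorphic_on_imp_differentiable_at\<close>)
    then show ?thesis
      by (subst (asm) has_contour_integral_part_circlepath_iff) (simp_all add: field_simps)
  qed
  \<comment> \<open>The winding number is found by applying the formula to the constant function 1,
    whose integral is known directly.\<close>
  have "((\<lambda>t. \<i>) has_integral (2 * pi * \<i> * W)) {-pi..pi}"
    using *[of "\<lambda>_. 1"] by simp
  moreover have "((\<lambda>t. \<i>) has_integral ((pi - (-pi)) *\<^sub>R \<i>)) {-pi..pi}"
    using has_integral_const_real[of \<i> "-pi" pi] by simp
  ultimately have "2 * pi * \<i> * W = (pi - (-pi)) *\<^sub>R \<i>"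
    by (rule has_integral_unique)
  then have "W = 1"
    by (simp add: scaleR_conv_of_real)
  then have "((\<lambda>t. (-\<i>) * (\<i> * f (cis t))) has_integral ((-\<i>) * (2 * pi * \<i> * f 0))) {-pi..pi}"
    using *[OF cont hol] by (intro has_integral_mult_right) simp
  moreover have "(-\<i>) * (2 * pi * \<i> * f 0) = 2 * pi * f 0" "(-\<i>) * (\<i> * w) = w" for w
    by (simp_all add: complex_eq_iff)
  ultimately show ?thesis
    by (simp only:)
qed

text \<open>Cramer's rule extends each entry of \<open>u\<close> from the circle to a holomorphic
  function on the closed disk. At \<open>z = 0\<close> the system matrix is the identity, so the
  mean value is the entry of \<open>l\<close>.\<close>

lemma has_integral_resolvent:
  assumes "schur_stable M"
    and u: "\<And>t. (mat 1 - mat (cis t) ** cmat (transpose M)) *v u t = l"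
  shows "((\<lambda>t. u t $ k) has_integral (2 * pi * l $ k)) {-pi..pi}"
proof -
  let ?F = "\<lambda>z. mat 1 - mat z ** cmat (transpose M)"
  let ?K = "\<lambda>z. \<chi> i j. if j = k then l $ i else ?F z $ i $ j"
  define f where "f = (\<lambda>z. det (?K z) / det (?F z))"
  have nz: "det (?F z) \<noteq> 0" if "norm z \<le> 1" for z
    using schur_stable_det_nz[OF assms(1) that] .
  have sol: "f z = x $ k" if "norm z \<le> 1" "?F z *v x = l" for z x
    using that(2) by (simp add: cramer[OF nz[OF that(1)]] f_def)
  have F: "(\<lambda>z. ?F z $ i $ j) holomorphic_on S" for S i j
    by (simp add: mat_matrix_mult_nth) (intro holomorphic_intros)
  have K: "(\<lambda>z. ?K z $ i $ j) holomorphic_on S" for S i j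
    using F by (cases "j = k") auto
  have "f holomorphic_on cball 0 1"
    unfolding f_def using nz by (intro holomorphic_intros holomorphic_on_det F K) simp
  then have "((\<lambda>t. f (cis t)) has_integral (2 * pi * f 0)) {-pi..pi}"
    using mean_value_unit_circle holomorphic_on_imp_continuous_on holomorphic_on_subset
      ball_subset_cball by blast
  moreover have "f (cis t) = u t $ k" for t
    using u by (intro sol) auto
  moreover have "f 0 = l $ k"
    by (intro sol) (auto simp: matrix_vector_mult_diff_rdistrib)
  ultimately show ?thesis
    by simp
qed

subsection \<open>The two norms\<close>

lemma continuous_on_transfer_function:
  assumes "schur_stable M"
  shows "continuous_on S (\<lambda>t. transfer_function L M N (cis t))"
proof -
  have "continuous_on S (\<lambda>t. mat (cis t) - cmat M)"
  proof -
    have "continuous_on S (\<lambda>t. (if i = j then cis t else 0) - cmat M $ i $ j)" for i j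
      by (cases "i = j") (auto intro!: continuous_intros)
    from continuous_on_vec_lambda[OF continuous_on_vec_lambda[OF this]]
    have "continuous_on S (\<lambda>t. \<chi> i j. (if i = j then cis t else 0) - cmat M $ i $ j)" .
    moreover have "mat (cis t) - cmat M = (\<chi> i j. (if i = j then cis t else 0) - cmat M $ i $ j)" for t
      by (simp add: vec_eq_iff mat_def)
    ultimately show ?thesis
      by simp
  qed
  then show ?thesis
    unfolding transfer_function_def
    by (intro continuous_on_matrix_mult continuous_on_const continuous_on_matrix_inv
        schur_stable_invertible[OF assms]) auto
qed

text \<open>The squared Frobenius norm is summed over the rows of \<open>H\<close>, one per output,
  because the Lyapunov inequality acts on the transposed system.\<close>

lemma trace_gram:
  fixes H :: "complex^'m^'q"
  shows "Re (trace (conj_transpose H ** H)) = (\<Sum>j\<in>UNIV. (norm (conj_transpose H *v axis j 1))\<^sup>2)"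
proof -
  have "Re (trace (conj_transpose H ** H)) = Re (trace (H ** conj_transpose H))"
    by (subst trace_mul_sym) (rule refl)
  also have "\<dots> = (\<Sum>j\<in>UNIV. \<Sum>k\<in>UNIV. (norm (H $ j $ k))\<^sup>2)"
    by (simp add: trace_def matrix_matrix_mult_def complex_norm_square[symmetric] del: of_real_power)
  also have "\<dots> = (\<Sum>j\<in>UNIV. (norm (conj_transpose H *v axis j 1))\<^sup>2)"
    by (simp add: norm_vec_def L2_set_def matrix_vector_mult_axis sum_nonneg)
  finally show ?thesis .
qed

text \<open>By cyclicity the trace is that of \<open>L Y L^T\<close>, a sum of quadratic forms at
  the rows of \<open>L\<close>. They are stated over the complex numbers to fit the block-matrix
  lemmas.\<close>

lemma trace_congruence:
  fixes Y :: "real^'n^'n" and L :: "real^'n^'q"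
  shows "trace (Y ** transpose L ** L)
    = (\<Sum>j\<in>UNIV. (cmat (transpose L) *v axis j 1) \<bullet> (cmat Y *v (cmat (transpose L) *v axis j 1)))"
proof -
  have "trace (Y ** transpose L ** L) = trace (L ** (Y ** transpose L))"
    by (rule trace_mul_sym)
  then show ?thesis
    by (simp add: trace_def inner_vec_def inner_complex_def matrix_vector_mult_axis)
      (simp add: matrix_matrix_mult_def matrix_vector_mult_def[of "cmat Y"] transpose_def
        matrix_vector_mult_axis)
qed

lemma h2_norm_transfer_function_le:
  fixes M P :: "real^'n^'n" and N :: "real^'w^'n" and L :: "real^'n^'q"
  assumes stable: "schur_stable M" and P: "transpose P = P"
    and lyap: "\<And>x. (norm (cmat (transpose N) *v x))\<^sup>2
      \<le> x \<bullet> (cmat P *v x) - (cmat (transpose M) *v x) \<bullet> (cmat P *v (cmat (transpose M) *v x))"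
  shows "(h2_norm (transfer_function L M N))\<^sup>2 \<le> trace (P ** transpose L ** L)"
proof -
  define H where "H = (\<lambda>t. transfer_function L M N (cis t))"
  define R where "R = (\<lambda>t. matrix_inv (mat (cis t) - cmat M))"
  define l where "l = (\<lambda>j. cmat (transpose L) *v axis j 1)"
  \<comment> \<open>On the unit circle the factor \<open>cnj z\<close> turns
    \<open>(cnj z I - M^T)^-1 l\<close> into \<open>(I - z M^T)^-1 l\<close>, which is holomorphic
    in \<open>z\<close>.\<close>
  define u where "u = (\<lambda>j t. cnj (cis t) *s (conj_transpose (R t) *v l j))"
  define g where "g = (\<lambda>t. Re (trace (conj_transpose (H t) ** H t)))"
  have HR: "conj_transpose (H t) *v axis j 1
      = cmat (transpose N) *v (conj_transpose (R t) *v l j)" for t j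
    by (simp add: H_def R_def l_def transfer_function_def conj_transpose_matrix_mul
        matrix_vector_mul_assoc matrix_mul_assoc)
  have RM: "(mat (cnj (cis t)) - cmat (transpose M)) *v (conj_transpose (R t) *v v) = v" for t v
  proof -
    have "R t ** (mat (cis t) - cmat M) = mat 1"
      unfolding R_def by (intro matrix_inv_mult schur_stable_invertible stable) simp
    then have "conj_transpose (R t ** (mat (cis t) - cmat M)) = mat 1"
      by simp
    then show ?thesis
      by (simp add: conj_transpose_matrix_mul conj_transpose_diff matrix_vector_mul_assoc)
  qed
  have Mx: "cmat (transpose M) *v (conj_transpose (R t) *v l j) = u j t - l j" for j t
    using RM[of t "l j"] by (simp add: u_def matrix_vector_mult_diff_rdistrib mat_vector_mult algebra_simps)
  have "(mat 1 - mat (cis t) ** cmat (transpose M)) *v u j t = l j" for j t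
  proof -
    have "cis t *s u j t = conj_transpose (R t) *v l j"
      by (simp add: u_def vector_smult_assoc cis_cnj flip: cis_inverse)
    then have "cis t *s (cmat (transpose M) *v u j t) = u j t - l j"
      by (simp add: Mx flip: vector_scalar_commute)
    then show ?thesis
      by (simp add: matrix_vector_mult_diff_rdistrib mat_vector_mult flip: matrix_vector_mul_assoc)
  qed
  then have mean: "((\<lambda>t. u j t $ k) has_integral (2 * pi * l j $ k)) {-pi..pi}" for j k
    by (rule has_integral_resolvent[OF stable])
  have mean_inner: "((\<lambda>t. u j t \<bullet> v) has_integral (2 * pi * (l j \<bullet> v))) {-pi..pi}" for j v
  proof -
    have "((\<lambda>t. u j t $ k \<bullet> v $ k) has_integral ((2 * pi * l j $ k) \<bullet> v $ k)) {-pi..pi}" for k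
      using has_integral_linear[OF mean bounded_linear_inner_left] by (simp add: o_def)
    then have "((\<lambda>t. \<Sum>k\<in>UNIV. u j t $ k \<bullet> v $ k)
        has_integral (\<Sum>k\<in>UNIV. (2 * pi * l j $ k) \<bullet> v $ k)) {-pi..pi}"
      by (intro has_integral_sum) auto
    moreover have "(2 * complex_of_real pi * x) \<bullet> y = 2 * pi * (x \<bullet> y)" for x y
      by (simp add: inner_complex_def algebra_simps)
    ultimately show ?thesis
      by (simp add: inner_vec_def sum_distrib_left)
  qed
  \<comment> \<open>In the Lyapunov bound at \<open>?x\<close>, the vector \<open>M^T ?x\<close>
    equals \<open>u - l\<close>. As \<open>u\<close> is a unimodular multiple of \<open>?x\<close>,
    the terms quadratic in \<open>u\<close> cancel and the bound is affine in \<open>u\<close>, so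
    it can be averaged exactly.\<close>
  have pointwise: "(norm (conj_transpose (H t) *v axis j 1))\<^sup>2
      \<le> 2 * (u j t \<bullet> (cmat P *v l j)) - l j \<bullet> (cmat P *v l j)" for t j
  proof -
    let ?x = "conj_transpose (R t) *v l j"
    have "u j t \<bullet> (cmat P *v u j t) = ?x \<bullet> (cmat P *v ?x)"
      unfolding u_def by (simp add: vector_scalar_commute inner_complex_scale)
    moreover have "l j \<bullet> (cmat P *v u j t) = u j t \<bullet> (cmat P *v l j)"
      by (subst inner_cmat_vector_mult) (simp add: P inner_commute)
    ultimately show ?thesis
      using lyap[of ?x] unfolding HR Mx
      by (simp add: matrix_vector_mult_diff_distrib inner_diff_left inner_diff_right)
  qed
  have "continuous_on {-pi..pi} H"
    unfolding H_def by (rule continuous_on_transfer_function[OF stable])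
  then have cont: "continuous_on {-pi..pi} g"
    unfolding g_def trace_def matrix_matrix_mult_def
    by (simp add: continuous_intros)
  \<comment> \<open>Integrability makes the Lebesgue integral of \<open>h2_norm\<close> agree with
    the gauge integral of the mean value property.\<close>
  have int: "set_integrable lborel {-pi..pi} g"
    by (rule borel_integrable_atLeastAtMost'[OF cont])
  have "(g has_integral (LBINT t:{-pi..pi}. g t)) {-pi..pi}"
    using set_borel_integral_eq_integral[OF int] by (simp add: has_integral_integral)
  \<comment> \<open>The mean of \<open>u j\<close> is \<open>l j\<close>, so two copies of
    \<open>l^T P l\<close> minus one remain.\<close>
  moreover have "((\<lambda>t. \<Sum>j\<in>UNIV. 2 * (u j t \<bullet> (cmat P *v l j)) - l j \<bullet> (cmat P *v l j)) has_integral
      (\<Sum>j\<in>UNIV. 2 * (2 * pi * (l j \<bullet> (cmat P *v l j))) - 2 * pi * (l j \<bullet> (cmat P *v l j))))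
      {-pi..pi}"
    using has_integral_const_real[of "l j \<bullet> (cmat P *v l j)" "-pi" pi for j]
    by (intro has_integral_sum has_integral_diff has_integral_mult_right mean_inner) simp_all
  moreover have "g t \<le> (\<Sum>j\<in>UNIV. 2 * (u j t \<bullet> (cmat P *v l j)) - l j \<bullet> (cmat P *v l j))" for t
    unfolding g_def trace_gram by (intro sum_mono pointwise)
  ultimately have "(LBINT t:{-pi..pi}. g t)
      \<le> (\<Sum>j\<in>UNIV. 2 * (2 * pi * (l j \<bullet> (cmat P *v l j))) - 2 * pi * (l j \<bullet> (cmat P *v l j)))"
    by (rule has_integral_le)
  also have "\<dots> = 2 * pi * trace (P ** transpose L ** L)"
    by (simp add: trace_congruence l_def sum_distrib_left mult.assoc)
  finally have "(LBINT t:{-pi..pi}. g t) \<le> 2 * pi * trace (P ** transpose L ** L)" .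
  then have "1 / (2 * pi) * (LBINT t:{-pi..pi}. g t) \<le> trace (P ** transpose L ** L)"
    by (simp add: field_simps)
  \<comment> \<open>Squaring undoes the \<open>sqrt\<close> in \<open>h2_norm\<close> only for a
    nonnegative argument.\<close>
  moreover have "(LBINT t:{-pi..pi}. g t) \<ge> 0"
    unfolding g_def trace_gram set_lebesgue_integral_def
    by (intro Bochner_Integration.integral_nonneg) (simp add: sum_nonneg)
  ultimately show ?thesis
    by (simp add: h2_norm_def g_def H_def)
qed

lemma hinf_norm_transfer_function:
  fixes L :: "real^'n^'q" and N :: "real^'m^'n"
  assumes stable: "schur_stable M"
    and gain: "\<And>z w. norm z = 1 \<Longrightarrow> norm (transfer_function L M N z *v w) \<le> c * norm w"
  shows "0 \<le> hinf_norm (transfer_function L M N)"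
    and "hinf_norm (transfer_function L M N) \<le> ereal c"
proof -
  define \<Omega> where "\<Omega> = restrict_space lborel {-pi..<pi}"
  define s where "s = (\<lambda>t. ereal (sigma_max (transfer_function L M N (cis t))))"
  have "continuous_on UNIV (\<lambda>t. sigma_max (transfer_function L M N (cis t)))"
    by (intro continuous_on_sigma_max continuous_on_transfer_function stable)
  then have meas: "s \<in> borel_measurable \<Omega>"
    unfolding s_def \<Omega>_def
    by (intro borel_measurable_ereal measurable_restrict_space1)
       (simp add: borel_measurable_continuous_onI)
  \<comment> \<open>On a space of positive measure the essential supremum of the constant 0 is 0
    rather than minus infinity.\<close>
  have "emeasure \<Omega> (space \<Omega>) \<noteq> 0"
    by (simp add: \<Omega>_def space_restrict_space emeasure_restrict_space)
  then have "0 = esssup \<Omega> (\<lambda>_. 0 :: ereal)"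
    by (simp add: esssup_const)
  also have "\<dots> \<le> esssup \<Omega> s"
    by (intro esssup_mono) (auto simp: s_def sigma_max_nonneg)
  finally show "0 \<le> hinf_norm (transfer_function L M N)"
    by (simp add: hinf_norm_def \<Omega>_def s_def)
  have "esssup \<Omega> s \<le> ereal c"
    using meas by (intro esssup_I) (auto simp: s_def intro!: sigma_max_le gain)
  then show "hinf_norm (transfer_function L M N) \<le> ereal c"
    by (simp add: hinf_norm_def \<Omega>_def s_def)
qed

subsection \<open>Consequences of the matrix inequalities\<close>

lemma matrix_diff_ldistrib:
  fixes A :: "'a::ring_1^'n^'m"
  shows "A ** (B - C) = A ** B - A ** C"
  by (simp add: vec_eq_iff matrix_matrix_mult_def right_diff_distrib sum_subtractf)

lemma inner_cmat_scale:
  "(z *s a) \<bullet> (cmat X *v (z *s b)) = (norm z)\<^sup>2 * (a \<bullet> (cmat X *v b))"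
  by (simp add: vector_scalar_commute inner_complex_scale)

text \<open>Supplies the positivity, and hence the invertibility, of \<open>X\<close>. A real test
  vector is embedded into the complex ones to reuse \<open>posdef_sym_block3\<close>.\<close>

lemma posdef_sym_block3_diag1:
  fixes P11 :: "real^'n^'n"
  assumes "posdef (sym_block3 P11 P12 P13 P22 P23 P33)"
  shows "posdef P11"
  unfolding posdef_def
proof safe
  define S where "S = sym_block3 P11 P12 P13 P22 P23 P33"
  have eq: "P11 $ i $ j = S $ Inl i $ Inl j" for i j
    by (simp add: S_def sym_block3_def sym_block2_def vcat_def hcat_def)
  have sym: "transpose S = S"
    using assms unfolding posdef_def S_def by blast
  have "S $ j $ i = S $ i $ j" for i j
    using arg_cong[OF sym, of "\<lambda>S. S $ i $ j"] unfolding transpose_def by simp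
  then show "transpose P11 = P11"
    by (simp add: vec_eq_iff transpose_def eq)
  fix x :: "real^'n" assume "x \<noteq> 0"
  define v where "v = (\<chi> i. complex_of_real (x $ i))"
  have "v \<noteq> 0"
    using \<open>x \<noteq> 0\<close> by (auto simp: v_def vec_eq_iff)
  then have "v \<bullet> (cmat P11 *v v) > 0"
    using posdef_sym_block3[OF assms, of v 0 0] by simp
  then show "x \<bullet> (P11 *v x) > 0"
    by (simp add: v_def inner_vec_def inner_complex_def matrix_vector_mult_def)
qed

text \<open>For an eigenvector \<open>v\<close> with eigenvalue \<open>z\<close>, the test vector
  \<open>(- z v, v, 0)\<close> makes the block form equal to \<open>(1 - |z|^2) (v^* X v)\<close>,
  so positivity forces \<open>|z| < 1\<close>.\<close>

lemma lmi_schur_stable: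
  assumes lmi: "posdef (sym_block3 X (X ** M) (X ** N) X 0 (mat 1))"
  shows "schur_stable M"
  unfolding schur_stable_def eigenvalue_def
proof safe
  fix z v assume v: "v \<noteq> 0" "cmat M *v v = z *s v"
  define h where "h = v \<bullet> (cmat X *v v)"
  have "h > 0"
    unfolding h_def using posdef_cmat[OF posdef_sym_block3_diag1[OF lmi] v(1)] .
  have XM: "cmat (X ** M) *v v = cmat X *v (z *s v)"
    using v(2) by (simp add: cmat_matrix_mul flip: matrix_vector_mul_assoc)
  have "0 < (norm z)\<^sup>2 * h - 2 * ((norm z)\<^sup>2 * h) + h"
    using posdef_sym_block3[OF lmi, of "- (z *s v)" v 0] v(1)
    unfolding XM by (simp add: matrix_vector_mult_minus_right inner_cmat_scale h_def)
  then have "0 < (1 - (norm z)\<^sup>2) * h"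
    by (simp add: algebra_simps)
  then have "(norm z)\<^sup>2 < 1\<^sup>2"
    using \<open>h > 0\<close> by (simp add: zero_less_mult_iff)
  then show "norm z < 1"
    by (rule power_less_imp_less_base) simp
qed

text \<open>Minimising the quadratic form of the block matrix over its last two arguments gives the
  Lyapunov inequality \<open>P - M P M\<^sup>T - N N\<^sup>T \<succeq> 0\<close> for \<open>P = X\<^sup>-\<^sup>1\<close>.\<close>

lemma lmi_lyapunov:
  fixes X M :: "real^'n^'n" and N :: "real^'w^'n"
  assumes lmi: "posdef (sym_block3 X (X ** M) (X ** N) X 0 (mat 1))"
  defines "P \<equiv> matrix_inv X"
  shows "(norm (cmat (transpose N) *v x))\<^sup>2
    \<le> x \<bullet> (cmat P *v x) - (cmat (transpose M) *v x) \<bullet> (cmat P *v (cmat (transpose M) *v x))"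
proof (cases "x = 0")
  case False
  have X: "posdef X"
    using posdef_sym_block3_diag1[OF lmi] .
  have XP: "cmat X *v (cmat P *v v) = v" for v
    using matrix_inv_mult(1)[OF posdef_invertible[OF X]]
    by (simp add: P_def matrix_vector_mul_assoc flip: cmat_matrix_mul)
  have XK: "(cmat P *v x) \<bullet> (cmat (X ** K) *v v) = (cmat (transpose K) *v x) \<bullet> v"
    for K :: "real^'k^'n" and v
  proof -
    have "transpose X = X"
      using X by (simp add: posdef_def)
    then have "(cmat P *v x) \<bullet> (cmat (X ** K) *v v) = (cmat X *v (cmat P *v x)) \<bullet> (cmat K *v v)"
      by (simp add: cmat_matrix_mul inner_matrix_vector_mult[of _ "cmat X"]
          flip: matrix_vector_mul_assoc)
    then show ?thesis
      by (simp add: XP inner_cmat_vector_mult)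
  qed
  define y where "y = cmat (transpose M) *v x"
  define n where "n = cmat (transpose N) *v x"
  have "cmat P *v x \<noteq> 0"
    using XP[of x] False by auto
  \<comment> \<open>With first component \<open>P x\<close>, the minimising second and third
    components are \<open>- P M^T x\<close> and \<open>- N^T x\<close>.\<close>
  then have "0 < (cmat P *v x) \<bullet> x - 2 * (y \<bullet> (cmat P *v y)) - 2 * (n \<bullet> n)
      + (cmat P *v y) \<bullet> y + n \<bullet> n"
    using posdef_sym_block3[OF lmi, of "cmat P *v x" "- (cmat P *v y)" "- n"]
    by (simp add: XP XK matrix_vector_mult_minus_right flip: y_def n_def)
  then show ?thesis
    unfolding power2_norm_eq_inner y_def[symmetric] n_def[symmetric]
    by (simp add: inner_commute)
qed simp

text \<open>The Schur complement of \<open>X\<close> shows that \<open>X^-1\<close> lies below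
  \<open>Y\<close>: the test vector \<open>(v, - X^-1 v)\<close> is the minimiser for fixed
  \<open>v\<close>. Summing over the rows of \<open>L\<close> gives the traces.\<close>

lemma lmi_trace_le:
  fixes X Y :: "real^'n^'n" and L :: "real^'n^'q"
  assumes lmi: "posdef (sym_block2 Y (mat 1) X)" and inv: "invertible X"
  shows "trace (matrix_inv X ** transpose L ** L) \<le> trace (Y ** transpose L ** L)"
proof -
  let ?P = "cmat (matrix_inv X)"
  have "v \<bullet> (?P *v v) \<le> v \<bullet> (cmat Y *v v)" for v
  proof (cases "v = 0")
    case False
    have "cmat X *v (?P *v v) = v"
      by (simp add: matrix_vector_mul_assoc matrix_inv_mult(1)[OF inv] flip: cmat_matrix_mul)
    then show ?thesis
      using posdef_sym_block2[OF lmi, of v "- (?P *v v)"] False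
      by (simp add: matrix_vector_mult_minus_right inner_commute)
  qed simp
  then show ?thesis
    unfolding trace_congruence by (intro sum_mono) auto
qed

text \<open>The test vector has the state \<open>x\<close> and its successor \<open>z x\<close> as components; their
  contributions cancel because \<open>z\<close> has modulus 1, which leaves only input and output.\<close>

lemma lmi_gain:
  fixes X M :: "real^'n^'n" and K :: "real^'m^'n" and L :: "real^'n^'q"
  assumes lmi: "posdef (sym_block4 X 0 (X ** M) (X ** K) (\<gamma> *\<^sub>R mat 1) L 0 X 0 (mat 1))"
    and stable: "schur_stable M" and z: "norm z = 1"
  shows "\<gamma> > 0" and "norm (transfer_function L M K z *v w) \<le> sqrt \<gamma> * norm w"
proof -
  have "0 < (norm b)\<^sup>2 * \<gamma>" if "b \<noteq> 0" for b :: "complex^'q"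
    using posdef_sym_block4[OF lmi, of 0 b 0 0] that
    by (simp add: cmat_scaleR scaleR_matrix_vector_mult mult.commute power2_norm_eq_inner)
  from this[of 1] show \<gamma>: "\<gamma> > 0"
    by (simp add: zero_less_mult_iff)
  show "norm (transfer_function L M K z *v w) \<le> sqrt \<gamma> * norm w"
  proof (cases "w = 0")
    case False
    define x where "x = matrix_inv (mat z - cmat M) *v (cmat K *v w)"
    define y where "y = cmat L *v x"
    have y: "transfer_function L M K z *v w = y"
      by (simp add: transfer_function_def x_def y_def matrix_vector_mul_assoc matrix_mul_assoc)
    have "(mat z - cmat M) *v x = cmat K *v w"
      using schur_stable_invertible[OF stable, of z] z
      by (simp add: x_def matrix_vector_mul_assoc matrix_inv_mult matrix_mul_assoc)
    then have "z *s x = cmat M *v x + cmat K *v w"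
      by (simp add: matrix_vector_mult_diff_rdistrib mat_vector_mult algebra_simps)
    then have dyn: "cmat (X ** M) *v x + cmat (X ** K) *v w = cmat X *v (z *s x)"
      by (simp add: cmat_matrix_mul matrix_vector_right_distrib flip: matrix_vector_mul_assoc)
    define h where "h = x \<bullet> (cmat X *v x)"
    have a: "(z *s x) \<bullet> (cmat X *v (z *s x)) = h"
      by (simp add: inner_cmat_scale z h_def)
    then have "(z *s x) \<bullet> (cmat (X ** M) *v x) + (z *s x) \<bullet> (cmat (X ** K) *v w) = h"
      by (simp add: dyn flip: inner_add_right)
    \<comment> \<open>The second component \<open>- y / \<gamma>\<close> minimises
      \<open>\<gamma> |b|^2 + 2 b \<bullet> y\<close>, with minimum
      \<open>- |y|^2 / \<gamma>\<close>; this is where the gain \<open>\<gamma>\<close> comes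
      from.\<close>
    moreover have "0 < h - 2 * ((z *s x) \<bullet> (cmat (X ** M) *v x))
        - 2 * ((z *s x) \<bullet> (cmat (X ** K) *v w)) + (y \<bullet> y) / \<gamma> - 2 * (y \<bullet> y) / \<gamma> + h + w \<bullet> w"
      using posdef_sym_block4[OF lmi, of "- (z *s x)" "- (1 / \<gamma>) *\<^sub>R y" x w] False \<gamma>
      by (simp add: cmat_scaleR scaleR_matrix_vector_mult matrix_vector_mult_scaleR_right
          matrix_vector_mult_minus_right a flip: y_def h_def)
    ultimately have "(y \<bullet> y) / \<gamma> \<le> w \<bullet> w"
      by simp
    then have "y \<bullet> y \<le> (w \<bullet> w) * \<gamma>"
      using \<gamma> by (simp add: pos_divide_le_eq)
    then have "(norm y)\<^sup>2 \<le> (sqrt \<gamma> * norm w)\<^sup>2"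
      unfolding power_mult_distrib power2_norm_eq_inner using \<gamma> by (simp add: mult.commute)
    then have "norm y \<le> sqrt \<gamma> * norm w"
      by (rule power2_le_imp_le) (use \<gamma> in simp)
    then show ?thesis
      by (simp only: y)
  qed simp
qed

theorem theorem6:
  fixes A :: "real^'n^'n" and B :: "real^'w^'n"
    and C :: "real^'n^'p" and D :: "real^'w^'p"
    and L :: "real^'n^'q" and T :: "real^'n^'n"
    and Y X :: "real^'n^'n" and Ghat :: "real^'p^'n"
    and \<mu> lam \<rho> :: real
  assumes "\<rho> > 0"
    and "rank D = CARD('p)"
    and "detectable A C"
    and "stabilizable A B"
    and "\<And>i j. i \<noteq> j \<Longrightarrow> T $ i $ j = 0"
    and "\<And>i. T $ i $ i \<in> {0, 1}"
    and "transpose Y = Y"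
    and "transpose X = X"
    and "trace (Y ** transpose L ** L) < \<mu>"
    and "posdef (sym_block2
           Y (mat 1)
             X)"
    and "posdef (sym_block3
           X (X ** A - Ghat ** C) (X ** B - Ghat ** D)
             X                    0
                                  (mat 1))"
    and "posdef (sym_block4
           X 0                              (X ** A - Ghat ** C) (Ghat ** C ** T)
             ((lam / \<rho>\<^sup>2) *\<^sub>R mat 1) L                      0
                                            X                    0
                                                                 (mat 1))"
  shows "(\<exists>G :: real^'p^'n.
            schur_stable (A - G ** C) \<and>
            (h2_norm (transfer_function L (A - G ** C) (B - G ** D)))\<^sup>2 \<le> \<mu> \<and>
            ereal (\<rho>\<^sup>2) * (hinf_norm (transfer_function L (A - G ** C) (G ** C ** T)))\<^sup>2 \<le> ereal lam) \<and>
         invertible X \<and>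
         (let G = matrix_inv X ** Ghat in
            schur_stable (A - G ** C) \<and>
            (h2_norm (transfer_function L (A - G ** C) (B - G ** D)))\<^sup>2 \<le> \<mu> \<and>
            ereal (\<rho>\<^sup>2) * (hinf_norm (transfer_function L (A - G ** C) (G ** C ** T)))\<^sup>2 \<le> ereal lam)"
proof -
  define G where "G = matrix_inv X ** Ghat"
  define M where "M = A - G ** C"
  define N where "N = B - G ** D"
  have inv: "invertible X"
    using posdef_invertible[OF posdef_sym_block3_diag1[OF assms(11)]] .
  have XG: "X ** (G ** K) = Ghat ** K" for K :: "real^'k^'p"
    by (simp add: G_def matrix_mul_assoc matrix_inv_mult(1)[OF inv])
  have XM: "X ** A - Ghat ** C = X ** M" and XN: "X ** B - Ghat ** D = X ** N"
    by (simp_all add: M_def N_def matrix_diff_ldistrib XG)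
  have XK: "Ghat ** C ** T = X ** (G ** C ** T)"
    using XG[of "C ** T"] by (simp add: matrix_mul_assoc)
  note lmi3 = assms(11)[unfolded XM XN] and lmi4 = assms(12)[unfolded XM XK]
  have stable: "schur_stable M"
    using lmi3 by (rule lmi_schur_stable)
  have "(h2_norm (transfer_function L M N))\<^sup>2 \<le> trace (matrix_inv X ** transpose L ** L)"
    using lmi_lyapunov[OF lmi3]
    by (intro h2_norm_transfer_function_le stable transpose_matrix_inv_eq inv assms(8))
  also have "\<dots> \<le> trace (Y ** transpose L ** L)"
    using assms(10) inv by (rule lmi_trace_le)
  finally have h2: "(h2_norm (transfer_function L M N))\<^sup>2 \<le> \<mu>"
    using assms(9) by simp
  define \<gamma> where "\<gamma> = lam / \<rho>\<^sup>2"
  have "\<gamma> > 0"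
    unfolding \<gamma>_def by (rule lmi_gain(1)[OF lmi4 stable norm_one])
  let ?n = "hinf_norm (transfer_function L M (G ** C ** T))"
  have n: "0 \<le> ?n" "?n \<le> ereal (sqrt \<gamma>)"
    unfolding \<gamma>_def using hinf_norm_transfer_function[OF stable lmi_gain(2)[OF lmi4 stable]] by auto
  \<comment> \<open>The two bounds exclude both infinities, so the square can be estimated in the
    reals.\<close>
  obtain r where r: "?n = ereal r"
    using n by (cases ?n) auto
  have "r\<^sup>2 \<le> (sqrt \<gamma>)\<^sup>2"
    using n unfolding r by (intro power_mono) auto
  then have "\<rho>\<^sup>2 * r\<^sup>2 \<le> lam"
    using \<open>\<gamma> > 0\<close> assms(1) by (simp add: \<gamma>_def field_simps)
  then have "ereal (\<rho>\<^sup>2) * ?n\<^sup>2 \<le> ereal lam"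
    unfolding r by (simp add: power2_eq_square)
  \<comment> \<open>The recovered matrix \<open>G\<close> also serves as the existential
    witness.\<close>
  then show ?thesis
    using stable h2 inv unfolding M_def N_def G_def Let_def by blast
qed

end
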